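(* The conditional probability function is a B-function: for a B-function $\mathfrak{b}$ and a sentence $C$, the function $B\mapsto\mathfrak{b}(B/C)$ given by $$\mathfrak{b}(B/C)=\frac{\mathfrak{b}(C\wedge B)}{\mathfrak{b}(C)}$$ (the conditional probability of $B$ for $C$) is a B-function.
   Context: A sentence $\ll\Theta\gg$ is true if and only if $\Theta$, and is false if and only if it is not that $\Theta$. Sentences $A$ and $B$ are equal ($A=B$) if $A$ is true if and only if $B$ is true. The conjunction $A\wedge B$ is true if and only if $A$ is true and $B$ is true; the negation $\overline{A}$ is true if and only if $A$ is false. A Boolean function is a function $\mathrm{g}$ from sentences to $\{0,1\}$ with $\mathrm{g}(\overline{A})=1-\mathrm{g}(A)$ and $\mathrm{g}(A\wedge B)=\mathrm{g}(A)\cdot\mathrm{g}(B)$ for all sentences $A,B$. A set $\Im$ of sentences is a basic set if for every $A\in\Im$ there exist Boolean functions $\mathrm{g}_1,\mathrm{g}_2$ with $\mathrm{g}_1(A)\neq\mathrm{g}_2(A)$ and $\mathrm{g}_1(B)=\mathrm{g}_2(B)$ for each $B\in\Im$ with $B\neq A$. Fix a basic set $\Im$. The $\Im$-sentences are the elements of $\Im$ together with everything obtained from them by negation and conjunction, and nothing else; only $\Im$-sentences are considered. A B-function is a function $\mathfrak{b}$ from sentences to $[0,1]$ such that $\mathfrak{b}(D)=1$ for some sentence $D$, and $\mathfrak{b}(A\wedge B)+\mathfrak{b}(A\wedge\overline{B})=\mathfrak{b}(A)$ for all sentences $A,B$. *)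

theory Defs
  imports Complex_Main
begin

text \<open>
  Truth of a sentence depends on the state of affairs, an element of the arbitrary type 'w:
  holds w \<open>\<guillemotleft>\<Theta>\<guillemotright>\<close> means that \<open>\<Theta>\<close> is the case in w. Hence "A is true if and only if B is true"
  is read as agreement in all states of affairs. With a single fixed state there would be only
  two sentences, one Boolean function, and no nonempty basic set; that degenerate reading is the
  instance where 'w has one element.

  Equality of sentences is HOL equality, so every HOL function on 's is well defined on sentences.
\<close>

locale sentences =
  fixes holds :: "'w \<Rightarrow> 's \<Rightarrow> bool"
    and neg :: "'s \<Rightarrow> 's"
    and cnjn :: "'s \<Rightarrow> 's \<Rightarrow> 's"
  assumes sentence_eq_iff: "A = B \<longleftrightarrow> (\<forall>w. holds w A \<longleftrightarrow> holds w B)"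
    and holds_neg: "holds w (neg A) \<longleftrightarrow> \<not> holds w A"
    and holds_cnjn: "holds w (cnjn A B) \<longleftrightarrow> holds w A \<and> holds w B"

definition boolean_function :: "('s \<Rightarrow> 's) \<Rightarrow> ('s \<Rightarrow> 's \<Rightarrow> 's) \<Rightarrow> ('s \<Rightarrow> real) \<Rightarrow> bool" where
  "boolean_function neg cnjn g \<longleftrightarrow>
     (\<forall>A. g A \<in> {0, 1}) \<and>
     (\<forall>A. g (neg A) = 1 - g A) \<and>
     (\<forall>A B. g (cnjn A B) = g A * g B)"

definition basic_set :: "('s \<Rightarrow> 's) \<Rightarrow> ('s \<Rightarrow> 's \<Rightarrow> 's) \<Rightarrow> 's set \<Rightarrow> bool" where
  "basic_set neg cnjn I \<longleftrightarrow>
     (\<forall>A\<in>I. \<exists>g1 g2. boolean_function neg cnjn g1 \<and> boolean_function neg cnjn g2 \<and>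
        g1 A \<noteq> g2 A \<and> (\<forall>B\<in>I. B \<noteq> A \<longrightarrow> g1 B = g2 B))"

inductive_set generated_sentences ::
    "('s \<Rightarrow> 's) \<Rightarrow> ('s \<Rightarrow> 's \<Rightarrow> 's) \<Rightarrow> 's set \<Rightarrow> 's set"
  for neg cnjn I where
  basic: "A \<in> I \<Longrightarrow> A \<in> generated_sentences neg cnjn I"
| neg: "A \<in> generated_sentences neg cnjn I \<Longrightarrow> neg A \<in> generated_sentences neg cnjn I"
| cnjn: "A \<in> generated_sentences neg cnjn I \<Longrightarrow> B \<in> generated_sentences neg cnjn I \<Longrightarrow>
    cnjn A B \<in> generated_sentences neg cnjn I"

text \<open>B-functions live on the \<open>I\<close>-sentences only; values elsewhere in 's are irrelevant.\<close>

definition B_function ::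
    "('s \<Rightarrow> 's) \<Rightarrow> ('s \<Rightarrow> 's \<Rightarrow> 's) \<Rightarrow> 's set \<Rightarrow> ('s \<Rightarrow> real) \<Rightarrow> bool" where
  "B_function neg cnjn I b \<longleftrightarrow>
     (\<forall>A \<in> generated_sentences neg cnjn I. b A \<in> {0..1}) \<and>
     (\<exists>D \<in> generated_sentences neg cnjn I. b D = 1) \<and>
     (\<forall>A \<in> generated_sentences neg cnjn I. \<forall>B \<in> generated_sentences neg cnjn I.
        b (cnjn A B) + b (cnjn A (neg B)) = b A)"

definition conditional_probability :: "('s \<Rightarrow> 's \<Rightarrow> 's) \<Rightarrow> ('s \<Rightarrow> real) \<Rightarrow> 's \<Rightarrow> 's \<Rightarrow> real" where
  "conditional_probability cnjn b C B = b (cnjn C B) / b C"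

end

theory Submission imports Defs begin

text \<open>
  Conditioning on \<open>C\<close> restricts the splitting identity of \<open>b\<close> to sentences of the form
  \<open>C \<and> A\<close>. Associativity of conjunction turns the instance at \<open>C \<and> A\<close> and \<open>B\<close>, divided by
  \<open>b C\<close>, into the splitting identity of the conditional probability. The instance at \<open>C\<close> and
  \<open>B\<close> gives monotonicity, \<open>b (C \<and> B) \<le> b C\<close>, hence values in \<open>{0..1}\<close>. By idempotence, \<open>C\<close>
  itself has conditional probability 1.
\<close>

text \<open>Equal sentences are those true in the same states, so Boolean identities are equations.\<close>

lemma (in sentences) cnjn_assoc: "cnjn (cnjn A B) D = cnjn A (cnjn B D)"
  by (subst sentence_eq_iff) (simp add: holds_cnjn)

lemma (in sentences) cnjn_idem: "cnjn A A = A"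
  by (subst sentence_eq_iff) (simp add: holds_cnjn)

text \<open>The part of \<open>b A\<close> that \<open>b (cnjn A B)\<close> leaves over is \<open>b (cnjn A (neg B)) \<ge> 0\<close>.\<close>

lemma B_function_cnjn_le:
  assumes "B_function neg cnjn I b"
    and "A \<in> generated_sentences neg cnjn I" and "B \<in> generated_sentences neg cnjn I"
  shows "b (cnjn A B) \<le> b A"
proof -
  have "b (cnjn A B) + b (cnjn A (neg B)) = b A"
    using assms by (simp add: B_function_def)
  moreover have "cnjn A (neg B) \<in> generated_sentences neg cnjn I"
    using assms(2,3) by (intro generated_sentences.cnjn generated_sentences.neg)
  hence "b (cnjn A (neg B)) \<ge> 0"
    using assms(1) by (simp add: B_function_def)
  ultimately show ?thesis by linarith
qed

theorem theorem6p1: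
  fixes holds :: "'w \<Rightarrow> 's \<Rightarrow> bool"
    and neg :: "'s \<Rightarrow> 's"
    and cnjn :: "'s \<Rightarrow> 's \<Rightarrow> 's"
    and I :: "'s set"
    and b :: "'s \<Rightarrow> real"
    and C :: 's
  assumes "sentences holds neg cnjn"
    and "basic_set neg cnjn I"
    and "B_function neg cnjn I b"
    and "C \<in> generated_sentences neg cnjn I"
    and "b C \<noteq> 0"
  shows "B_function neg cnjn I (\<lambda>B. conditional_probability cnjn b C B)"
proof -
  interpret sentences holds neg cnjn by (fact assms(1))
  let ?G = "generated_sentences neg cnjn I"
  have nonneg: "b A \<ge> 0" if "A \<in> ?G" for A
    using assms(3) that by (simp add: B_function_def)
  have pos: "b C > 0"
    using nonneg[OF assms(4)] assms(5) by simp
  show ?thesis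
    unfolding B_function_def conditional_probability_def
  proof (intro conjI ballI)
    fix A assume A: "A \<in> ?G"
    have "b (cnjn C A) \<ge> 0"
      using nonneg generated_sentences.cnjn[OF assms(4) A] by blast
    moreover have "b (cnjn C A) \<le> b C"
      by (rule B_function_cnjn_le[OF assms(3,4) A])
    ultimately show "b (cnjn C A) / b C \<in> {0..1}"
      using pos by simp
  next
    show "\<exists>D\<in>?G. b (cnjn C D) / b C = 1"
      using assms(4,5) by (intro bexI[of _ C]) (simp_all add: cnjn_idem)
  next
    fix A B assume A: "A \<in> ?G" and B: "B \<in> ?G"
    have "b (cnjn (cnjn C A) B) + b (cnjn (cnjn C A) (neg B)) = b (cnjn C A)"
      using assms(3) B generated_sentences.cnjn[OF assms(4) A] by (simp add: B_function_def)
    thus "b (cnjn C (cnjn A B)) / b C + b (cnjn C (cnjn A (neg B))) / b C = b (cnjn C A) / b C"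
      by (simp add: cnjn_assoc flip: add_divide_distrib)
  qed
qed

end
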